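(* Let $Z$ be a Hausdorff topological space with no isolated points, let $\mathcal{A}\subset\mathcal{P}(\mathbb{N})$ be a Furstenberg family, and let $f_1,\dots,f_N$ be a disjoint $\mathcal{A}$-transitive tuple of continuous maps $Z\to Z$. Suppose there exists a weakly mixing map $g\colon Z\to Z$ such that $g\circ f_i=f_i\circ g$ for $i=1,\dots,N$. Then for every integer $r\ge 1$ the $N$-tuple of $r$-fold product maps $$\underbrace{f_1\times\dots\times f_1}_{r\text{ times}},\ \dots,\ \underbrace{f_N\times\dots\times f_N}_{r\text{ times}}$$ acting on $Z^r$ is disjoint $\mathcal{A}$-transitive. In particular, $f_1,\dots,f_N$ are disjoint weakly mixing of order $r$ for every $r\ge 1$.
   Context: $\mathbb{N}=\{0,1,2,\dots\}$. A family $\mathcal{A}\subset\mathcal{P}(\mathbb{N})$ is a Furstenberg family if every $A\in\mathcal{A}$ is infinite, and $A\in\mathcal{A}$, $A\subset B\subset\mathbb{N}$ imply $B\in\mathcal{A}$. Let $h_1,\dots,h_N$ be continuous self-maps of a Hausdorff topological space $Y$. For non-empty open sets $U_0,\dots,U_N\subset Y$ the disjoint return set is $$\{m\in\mathbb{N}: U_0\cap h_1^{-m}(U_1)\cap\dots\cap h_N^{-m}(U_N)\neq\emptyset\},$$ where $h_i^{-m}(\cdot)$ denotes preimage under the $m$-th iterate. The tuple is disjoint transitive if all its disjoint return sets are non-empty, and disjoint $\mathcal{A}$-transitive if all its disjoint return sets (for non-empty open sets) belong to $\mathcal{A}$. The tuple $f_1,\dots,f_N$ on $Z$ is disjoint weakly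 mixing of order $r$ if the $N$-tuple of $r$-fold products $f_1\times\dots\times f_1,\dots,f_N\times\dots\times f_N$ acting on $Z^r$ (product topology) is disjoint transitive. A continuous map $h\colon Y\to Y$ is transitive if for all non-empty open $U,V\subset Y$ there is $m\in\mathbb{N}$ with $h^m(U)\cap V\ne\emptyset$. A weakly mixing map $g\colon Z\to Z$ is a continuous map such that $g\times g$ is transitive on $Z\times Z$. *)

theory Defs
  imports "HOL-Analysis.Analysis"
begin

text \<open>
  Spaces are abstract topologies \<open>Y :: 'a topology\<close>, so self-maps matter only on \<open>topspace Y\<close>.
  A tuple \<open>h\<^sub>1, \<dots>, h\<^sub>N\<close> is a family \<open>h\<close> restricted to the indices \<open>{1..N}\<close>;
  sets \<open>U\<^sub>0, \<dots>, U\<^sub>N\<close> are a family \<open>U\<close> restricted to \<open>{0..N}\<close>.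
\<close>

definition furstenberg_family :: "nat set set \<Rightarrow> bool" where
  "furstenberg_family \<A> \<longleftrightarrow>
     (\<forall>A\<in>\<A>. infinite A) \<and> (\<forall>A B. A \<in> \<A> \<longrightarrow> A \<subseteq> B \<longrightarrow> B \<in> \<A>)"

definition no_isolated_points :: "'a topology \<Rightarrow> bool" where
  "no_isolated_points Y \<longleftrightarrow> (\<forall>x\<in>topspace Y. \<not> openin Y {x})"

text \<open>
  The preimages below are taken in the whole type; intersecting with \<open>U 0\<close>, which is
  contained in \<open>topspace Y\<close> whenever it is open, gives the same set as preimages in \<open>Y\<close>.
\<close>

definition disjoint_return_set ::
    "nat \<Rightarrow> (nat \<Rightarrow> 'a \<Rightarrow> 'a) \<Rightarrow> (nat \<Rightarrow> 'a set) \<Rightarrow> nat set" where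
  "disjoint_return_set N h U =
     {m. U 0 \<inter> (\<Inter>i\<in>{1..N}. (h i ^^ m) -` U i) \<noteq> {}}"

definition disjoint_transitive :: "'a topology \<Rightarrow> nat \<Rightarrow> (nat \<Rightarrow> 'a \<Rightarrow> 'a) \<Rightarrow> bool" where
  "disjoint_transitive Y N h \<longleftrightarrow>
     (\<forall>i\<in>{1..N}. continuous_map Y Y (h i)) \<and>
     (\<forall>U. (\<forall>j\<in>{0..N}. openin Y (U j) \<and> U j \<noteq> {}) \<longrightarrow> disjoint_return_set N h U \<noteq> {})"

definition disjoint_family_transitive ::
    "nat set set \<Rightarrow> 'a topology \<Rightarrow> nat \<Rightarrow> (nat \<Rightarrow> 'a \<Rightarrow> 'a) \<Rightarrow> bool" where
  "disjoint_family_transitive \<A> Y N h \<longleftrightarrow>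
     (\<forall>i\<in>{1..N}. continuous_map Y Y (h i)) \<and>
     (\<forall>U. (\<forall>j\<in>{0..N}. openin Y (U j) \<and> U j \<noteq> {}) \<longrightarrow> disjoint_return_set N h U \<in> \<A>)"

text \<open>
  Points of \<open>Y\<^sup>r\<close> are extensional functions on \<open>{..<r}\<close>, hence the restriction
  in the \<open>r\<close>-fold product map.
\<close>

definition power_space :: "nat \<Rightarrow> 'a topology \<Rightarrow> (nat \<Rightarrow> 'a) topology" where
  "power_space r Y = product_topology (\<lambda>_. Y) {..<r}"

definition power_map :: "nat \<Rightarrow> ('a \<Rightarrow> 'a) \<Rightarrow> (nat \<Rightarrow> 'a) \<Rightarrow> (nat \<Rightarrow> 'a)" where
  "power_map r h = (\<lambda>x. \<lambda>k\<in>{..<r}. h (x k))"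

definition disjoint_weakly_mixing_of_order ::
    "nat \<Rightarrow> 'a topology \<Rightarrow> nat \<Rightarrow> (nat \<Rightarrow> 'a \<Rightarrow> 'a) \<Rightarrow> bool" where
  "disjoint_weakly_mixing_of_order r Z N f \<longleftrightarrow>
     disjoint_transitive (power_space r Z) N (\<lambda>i. power_map r (f i))"

definition transitive_map :: "'a topology \<Rightarrow> ('a \<Rightarrow> 'a) \<Rightarrow> bool" where
  "transitive_map Y h \<longleftrightarrow>
     continuous_map Y Y h \<and>
     (\<forall>U V. openin Y U \<longrightarrow> openin Y V \<longrightarrow> U \<noteq> {} \<longrightarrow> V \<noteq> {} \<longrightarrow>
        (\<exists>m. (h ^^ m) ` U \<inter> V \<noteq> {}))"

definition weakly_mixing_map :: "'a topology \<Rightarrow> ('a \<Rightarrow> 'a) \<Rightarrow> bool" where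
  "weakly_mixing_map Z g \<longleftrightarrow>
     continuous_map Z Z g \<and> transitive_map (prod_topology Z Z) (map_prod g g)"

end

(* Furstenberg's intersection lemma makes the sets {m. g^m U meets V} a filter base, so
   finitely many of them have a common element. Choosing m_0, ..., m_(r-1) one after the other,
   this yields non-empty open sets V_0, ..., V_N such that g^(m_k) maps V_j into the k-th side of
   a box inside the given open set W_j of Z^r, for all j and k. As g commutes with every f_i, a
   point x witnessing a disjoint return of V gives the witness (g^(m_0) x, ..., g^(m_(r-1)) x) for
   the same return time of W. *)

theory Submission
  imports Defs
begin

lemma continuous_map_funpow:
  assumes "continuous_map X X h"
  shows "continuous_map X X (h ^^ n)"
proof (induction n)
  case (Suc n)
  then show ?case
    using continuous_map_compose[OF Suc assms] by (simp add: o_def)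
qed simp

text \<open>The preimage is taken in the whole type, so alone it may contain points outside the
  space; the open set \<open>U\<close> confines it to \<open>topspace X\<close>.\<close>

lemma openin_Int_preimage_funpow:
  assumes "continuous_map X X h" "openin X U" "openin X V"
  shows "openin X (U \<inter> (h ^^ n) -` V)"
proof -
  have "U \<inter> (h ^^ n) -` V = U \<inter> {x \<in> topspace X. (h ^^ n) x \<in> V}"
    using openin_subset[OF assms(2)] by blast
  then show ?thesis
    using openin_continuous_map_preimage[OF continuous_map_funpow[OF assms(1)] assms(3)] assms(2)
    by auto
qed

text \<open>Commutation is known only on the carrier, so iterating it relies on both maps keeping
  \<open>S\<close> invariant.\<close>

lemma funpow_commute_on:
  assumes "\<And>x. x \<in> S \<Longrightarrow> g (f x) = f (g x)" "\<And>x. x \<in> S \<Longrightarrow> f x \<in> S" "\<And>x. x \<in> S \<Longrightarrow> g x \<in> S"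
    and "x \<in> S"
  shows "(g ^^ m) ((f ^^ n) x) = (f ^^ n) ((g ^^ m) x)"
proof -
  have funpow_in: "(h ^^ k) y \<in> S" if "\<And>z. z \<in> S \<Longrightarrow> h z \<in> S" "y \<in> S" for h k y
    using that by (induction k) auto
  have g_fn: "g ((f ^^ n) y) = (f ^^ n) (g y)" if "y \<in> S" for y
    by (induction n) (use that assms(1) funpow_in[OF assms(2)] in auto)
  show ?thesis
    by (induction m) (use g_fn funpow_in[OF assms(3) \<open>x \<in> S\<close>] in auto)
qed

lemma map_prod_funpow:
  fixes g :: "'a \<Rightarrow> 'a" and h :: "'b \<Rightarrow> 'b"
  shows "(map_prod g h ^^ m) = map_prod (g ^^ m) (h ^^ m)"
  by (induction m) (auto simp: fun_eq_iff)

text \<open>A return time of \<open>A \<times> C\<close> to \<open>B \<times> D\<close> under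
  \<open>map_prod g g\<close> serves both coordinates at once.\<close>

lemma weakly_mixing_map_common_return:
  assumes "weakly_mixing_map Z g"
    and "openin Z A" "openin Z B" "openin Z C" "openin Z D"
    and "A \<noteq> {}" "B \<noteq> {}" "C \<noteq> {}" "D \<noteq> {}"
  shows "\<exists>m. A \<inter> (g ^^ m) -` B \<noteq> {} \<and> C \<inter> (g ^^ m) -` D \<noteq> {}"
proof -
  have "openin (prod_topology Z Z) (A \<times> C)" "openin (prod_topology Z Z) (B \<times> D)"
    using assms by (auto simp: openin_prod_Times_iff)
  moreover have "A \<times> C \<noteq> {}" "B \<times> D \<noteq> {}"
    using assms by auto
  ultimately obtain m where "(map_prod g g ^^ m) ` (A \<times> C) \<inter> (B \<times> D) \<noteq> {}"
    using assms(1) unfolding weakly_mixing_map_def transitive_map_def by meson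
  then show ?thesis
    by (intro exI[of _ m]) (auto simp: map_prod_funpow)
qed

text \<open>Two pairs of open sets can be merged into one whose return times are return times of
  both; induction on \<open>J\<close> then handles finitely many pairs.\<close>

lemma Furstenberg_intersection:
  assumes wm: "weakly_mixing_map Z g"
    and "finite J" "J \<noteq> {}"
    and "\<And>j. j \<in> J \<Longrightarrow> openin Z (U j) \<and> U j \<noteq> {}" "\<And>j. j \<in> J \<Longrightarrow> openin Z (V j) \<and> V j \<noteq> {}"
  shows "\<exists>A B. openin Z A \<and> A \<noteq> {} \<and> openin Z B \<and> B \<noteq> {} \<and>
           (\<forall>m. A \<inter> (g ^^ m) -` B \<noteq> {} \<longrightarrow> (\<forall>j\<in>J. U j \<inter> (g ^^ m) -` V j \<noteq> {}))"
  using assms(2-)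
proof (induction J rule: finite_ne_induct)
  case (singleton j)
  then show ?case by (intro exI[of _ "U j"] exI[of _ "V j"]) auto
next
  case (insert j J)
  have cont: "continuous_map Z Z g"
    using wm by (simp add: weakly_mixing_map_def)
  have "\<exists>A B. openin Z A \<and> A \<noteq> {} \<and> openin Z B \<and> B \<noteq> {} \<and>
      (\<forall>m. A \<inter> (g ^^ m) -` B \<noteq> {} \<longrightarrow> (\<forall>j\<in>J. U j \<inter> (g ^^ m) -` V j \<noteq> {}))"
    by (rule insert.IH) (use insert.prems in simp_all)
  then obtain A B where AB: "openin Z A" "A \<noteq> {}" "openin Z B" "B \<noteq> {}"
    and sub: "\<And>m. A \<inter> (g ^^ m) -` B \<noteq> {} \<Longrightarrow> \<forall>j\<in>J. U j \<inter> (g ^^ m) -` V j \<noteq> {}"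
    by metis
  have UV: "openin Z (U j)" "U j \<noteq> {}" "openin Z (V j)" "V j \<noteq> {}"
    using insert.prems by auto
  \<comment> \<open>Weak mixing is applied crosswise: sources \<open>A\<close>, \<open>B\<close> go
    to targets \<open>U j\<close>, \<open>V j\<close>, so that \<open>g ^^ k\<close> carries part of
    the old pair into the new one.\<close>
  obtain k where k: "A \<inter> (g ^^ k) -` U j \<noteq> {}" "B \<inter> (g ^^ k) -` V j \<noteq> {}"
    using weakly_mixing_map_common_return[OF wm AB(1) UV(1) AB(3) UV(3) AB(2) UV(2) AB(4) UV(4)]
    by blast
  let ?A = "A \<inter> (g ^^ k) -` U j" and ?B = "B \<inter> (g ^^ k) -` V j"
  have "\<forall>m. ?A \<inter> (g ^^ m) -` ?B \<noteq> {} \<longrightarrow> (\<forall>i\<in>insert j J. U i \<inter> (g ^^ m) -` V i \<noteq> {})"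
  proof (intro allI impI)
    fix m
    assume "?A \<inter> (g ^^ m) -` ?B \<noteq> {}"
    then obtain x where x: "x \<in> A" "(g ^^ k) x \<in> U j" "(g ^^ m) x \<in> B" "(g ^^ k) ((g ^^ m) x) \<in> V j"
      by auto
    \<comment> \<open>Powers of \<open>g\<close> commute, so \<open>(g ^^ k) x\<close> is a point of
      \<open>U j\<close> that reaches \<open>V j\<close> at time \<open>m\<close>.\<close>
    have "(g ^^ m) ((g ^^ k) x) \<in> V j"
      using x(4) by (metis add.commute comp_apply funpow_add)
    then have "U j \<inter> (g ^^ m) -` V j \<noteq> {}"
      using x(2) by auto
    moreover have "A \<inter> (g ^^ m) -` B \<noteq> {}"
      using x by auto
    ultimately show "\<forall>i\<in>insert j J. U i \<inter> (g ^^ m) -` V i \<noteq> {}"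
      using sub by simp
  qed
  moreover have "openin Z ?A" "openin Z ?B"
    by (simp_all only: openin_Int_preimage_funpow[OF cont] AB UV)
  ultimately show ?case
    using k by - (rule exI[of _ ?A], rule exI[of _ ?B], intro conjI)
qed

lemma weakly_mixing_map_common_return_finite:
  assumes "weakly_mixing_map Z g" "finite J"
    and "\<And>j. j \<in> J \<Longrightarrow> openin Z (U j) \<and> U j \<noteq> {}" "\<And>j. j \<in> J \<Longrightarrow> openin Z (V j) \<and> V j \<noteq> {}"
  shows "\<exists>m. \<forall>j\<in>J. U j \<inter> (g ^^ m) -` V j \<noteq> {}"
proof (cases "J = {}")
  case False
  then obtain A B where "openin Z A" "A \<noteq> {}" "openin Z B" "B \<noteq> {}"
    "\<And>m. A \<inter> (g ^^ m) -` B \<noteq> {} \<Longrightarrow> \<forall>j\<in>J. U j \<inter> (g ^^ m) -` V j \<noteq> {}"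
    using Furstenberg_intersection[OF assms(1,2)] assms(3,4) by metis
  then show ?thesis
    using weakly_mixing_map_common_return[OF assms(1)] by meson
qed auto

text \<open>Coordinates are treated one at a time: a time \<open>n\<close> common to all
  \<open>j\<close> brings part of each \<open>V j\<close> into \<open>U j r\<close>, and shrinking
  \<open>V j\<close> to that part keeps the earlier inclusions. The times \<open>m k\<close> do not
  depend on \<open>j\<close>, so one tuple of powers of \<open>g\<close> serves the source and all
  targets.\<close>

lemma weakly_mixing_map_simultaneous_return:
  fixes U :: "'b \<Rightarrow> nat \<Rightarrow> 'a set"
  assumes wm: "weakly_mixing_map Z g" and "finite J" "topspace Z \<noteq> {}"
    and U: "\<And>j k. \<lbrakk>j \<in> J; k < r\<rbrakk> \<Longrightarrow> openin Z (U j k) \<and> U j k \<noteq> {}"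
  shows "\<exists>m V. \<forall>j\<in>J. openin Z (V j) \<and> V j \<noteq> {} \<and> (\<forall>k<r. V j \<subseteq> (g ^^ m k) -` U j k)"
  using U
proof (induction r)
  case 0
  \<comment> \<open>With no coordinate to satisfy, the whole space serves as every
    \<open>V j\<close>; the times are arbitrary.\<close>
  show ?case
    using assms(3) by (intro exI[of _ "\<lambda>_. 0"] exI[of _ "\<lambda>_. topspace Z"]) auto
next
  case (Suc r)
  then obtain m :: "nat \<Rightarrow> nat" and V :: "'b \<Rightarrow> 'a set"
    where V: "\<And>j. j \<in> J \<Longrightarrow> openin Z (V j) \<and> V j \<noteq> {}"
      and sub: "\<And>j k. \<lbrakk>j \<in> J; k < r\<rbrakk> \<Longrightarrow> V j \<subseteq> (g ^^ m k) -` U j k"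
    by (metis less_SucI)
  have Ur: "openin Z (U j r) \<and> U j r \<noteq> {}" if "j \<in> J" for j
    using Suc.prems that by simp
  obtain n where n: "\<And>j. j \<in> J \<Longrightarrow> V j \<inter> (g ^^ n) -` U j r \<noteq> {}"
    using weakly_mixing_map_common_return_finite[of Z g J V "\<lambda>j. U j r"] wm \<open>finite J\<close> V Ur by metis
  let ?m = "m(r := n)" and ?V = "\<lambda>j. V j \<inter> (g ^^ n) -` U j r"
  have "openin Z (?V j)" if "j \<in> J" for j
    using openin_Int_preimage_funpow wm V Ur that unfolding weakly_mixing_map_def by blast
  moreover have "?V j \<subseteq> (g ^^ ?m k) -` U j k" if "j \<in> J" "k < Suc r" for j k
    using sub[of j k] that by (cases "k = r") auto
  ultimately have "\<forall>j\<in>J. openin Z (?V j) \<and> ?V j \<noteq> {} \<and> (\<forall>k<Suc r. ?V j \<subseteq> (g ^^ ?m k) -` U j k)"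
    using n by simp
  then show ?case
    by (intro exI)
qed

text \<open>A basic box around a chosen point of \<open>W\<close> has non-empty sides, since they
  contain the coordinates of that point.\<close>

lemma openin_power_space_contains_box:
  assumes "openin (power_space r Z) W" "W \<noteq> {}"
  shows "\<exists>U. (\<forall>k<r. openin Z (U k) \<and> U k \<noteq> {}) \<and> (\<Pi>\<^sub>E k\<in>{..<r}. U k) \<subseteq> W"
proof -
  obtain x where "x \<in> W"
    using assms(2) by auto
  then obtain U where "\<forall>k\<in>{..<r}. openin Z (U k)" "x \<in> (\<Pi>\<^sub>E k\<in>{..<r}. U k)"
    "(\<Pi>\<^sub>E k\<in>{..<r}. U k) \<subseteq> W"
    using assms(1) unfolding power_space_def openin_product_topology_alt by meson
  then show ?thesis
    by (intro exI[of _ U]) (auto simp: PiE_iff)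
qed

lemma power_map_funpow:
  assumes "x \<in> extensional {..<r}"
  shows "(power_map r h ^^ n) x = (\<lambda>k\<in>{..<r}. (h ^^ n) (x k))"
proof (induction n)
  case 0
  \<comment> \<open>The zeroth iterate is \<open>x\<close> itself, which equals its restriction
    because \<open>x\<close> is extensional.\<close>
  then show ?case using assms by (auto simp: fun_eq_iff extensional_def)
qed (auto simp: power_map_def fun_eq_iff)

lemma continuous_map_power_map:
  assumes "continuous_map Z Z h"
  shows "continuous_map (power_space r Z) (power_space r Z) (power_map r h)"
proof -
  have "continuous_map (product_topology (\<lambda>_. Z) {..<r}) Z (\<lambda>x. h (x k))" if "k < r" for k
    using continuous_map_compose[OF _ assms, of _ "\<lambda>x. x k"]
      continuous_map_product_projection[of k "{..<r}" "\<lambda>_. Z"] that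
    by (auto simp: o_def)
  then show ?thesis
    unfolding power_space_def power_map_def continuous_map_componentwise by auto
qed

text \<open>Powers of \<open>g\<close> spread one orbit in \<open>Z\<close> over the
  \<open>r\<close> coordinates without changing the return time. A lower bound by a return set of
  \<open>f\<close> is enough because Furstenberg families are upward closed.\<close>

lemma disjoint_return_set_power_map:
  assumes wm: "weakly_mixing_map Z g"
    and comm: "\<And>i x. \<lbrakk>i \<in> {1..N}; x \<in> topspace Z\<rbrakk> \<Longrightarrow> g (f i x) = f i (g x)"
    and cont: "\<And>i. i \<in> {1..N} \<Longrightarrow> continuous_map Z Z (f i)"
    and "topspace Z \<noteq> {}"
    and W: "\<And>j. j \<in> {0..N} \<Longrightarrow> openin (power_space r Z) (W j) \<and> W j \<noteq> {}"
  shows "\<exists>V. (\<forall>j\<in>{0..N}. openin Z (V j) \<and> V j \<noteq> {}) \<and>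
           disjoint_return_set N f V \<subseteq> disjoint_return_set N (\<lambda>i. power_map r (f i)) W"
proof -
  have "\<forall>j\<in>{0..N}. \<exists>U. (\<forall>k<r. openin Z (U k) \<and> U k \<noteq> {}) \<and> (\<Pi>\<^sub>E k\<in>{..<r}. U k) \<subseteq> W j"
    by (intro ballI openin_power_space_contains_box) (use W in simp_all)
  from bchoice[OF this] obtain U where "\<forall>j\<in>{0..N}. (\<forall>k<r. openin Z (U j k) \<and> U j k \<noteq> {}) \<and>
      (\<Pi>\<^sub>E k\<in>{..<r}. U j k) \<subseteq> W j"
    by (elim exE)
  then have U: "\<And>j k. \<lbrakk>j \<in> {0..N}; k < r\<rbrakk> \<Longrightarrow> openin Z (U j k) \<and> U j k \<noteq> {}"
    and box: "\<And>j. j \<in> {0..N} \<Longrightarrow> (\<Pi>\<^sub>E k\<in>{..<r}. U j k) \<subseteq> W j"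
    by simp_all
  have "\<exists>m V. \<forall>j\<in>{0..N}. openin Z (V j) \<and> V j \<noteq> {} \<and> (\<forall>k<r. V j \<subseteq> (g ^^ m k) -` U j k)"
    by (rule weakly_mixing_map_simultaneous_return[OF wm _ \<open>topspace Z \<noteq> {}\<close>]) (use U in simp_all)
  then obtain m V where mV: "\<forall>j\<in>{0..N}. openin Z (V j) \<and> V j \<noteq> {} \<and> (\<forall>k<r. V j \<subseteq> (g ^^ m k) -` U j k)"
    by (elim exE)
  then have V: "\<And>j. j \<in> {0..N} \<Longrightarrow> openin Z (V j) \<and> V j \<noteq> {}"
    by simp
  have VU: "\<And>j k x. \<lbrakk>j \<in> {0..N}; k < r; x \<in> V j\<rbrakk> \<Longrightarrow> (g ^^ m k) x \<in> U j k"
    using mV by (meson subsetD vimageE)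
  have "n \<in> disjoint_return_set N (\<lambda>i. power_map r (f i)) W"
    if "n \<in> disjoint_return_set N f V" for n
  proof -
    from that obtain x where x: "x \<in> V 0" "\<And>i. i \<in> {1..N} \<Longrightarrow> (f i ^^ n) x \<in> V i"
      unfolding disjoint_return_set_def by blast
    have xZ: "x \<in> topspace Z"
      using x(1) V[of 0] openin_subset by fastforce
    \<comment> \<open>This single point of the power has to work for every \<open>i\<close>, which
      is why the times \<open>m k\<close> were chosen uniformly in \<open>j\<close>.\<close>
    define y where "y = (\<lambda>k\<in>{..<r}. (g ^^ m k) x)"
    have "y \<in> (\<Pi>\<^sub>E k\<in>{..<r}. U 0 k)"
      using VU[of 0] x(1) by (auto simp: y_def)
    then have "y \<in> W 0"
      using box[of 0] by auto
    moreover have "(power_map r (f i) ^^ n) y \<in> W i" if i: "i \<in> {1..N}" for i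
    proof -
      have fZ: "f i z \<in> topspace Z" and gZ: "g z \<in> topspace Z" if "z \<in> topspace Z" for z
        using that cont[OF i] wm
        by (auto simp: weakly_mixing_map_def continuous_map_def)
      \<comment> \<open>By commutation this point is \<open>(g ^^ m k) ((f i ^^ n) x)\<close>, the
        image of a point of \<open>V i\<close>.\<close>
      have "(f i ^^ n) ((g ^^ m k) x) \<in> U i k" if "k < r" for k
        using funpow_commute_on[of "topspace Z" g "f i" x "m k" n, OF comm[OF i] fZ gZ xZ]
          VU[of i k "(f i ^^ n) x"] x(2)[OF i] that i by simp
      then have "(\<lambda>k\<in>{..<r}. (f i ^^ n) (y k)) \<in> (\<Pi>\<^sub>E k\<in>{..<r}. U i k)"
        by (auto simp: y_def)
      then have "(\<lambda>k\<in>{..<r}. (f i ^^ n) (y k)) \<in> W i"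
        by (rule subsetD[OF box, rotated]) (use i in simp)
      moreover have "y \<in> extensional {..<r}"
        by (simp add: y_def)
      ultimately show ?thesis
        by (simp add: power_map_funpow)
    qed
    ultimately show ?thesis
      unfolding disjoint_return_set_def by blast
  qed
  then show ?thesis
    using V by blast
qed

text \<open>Members of a Furstenberg family are infinite, hence non-empty.\<close>

lemma disjoint_family_transitive_imp_disjoint_transitive:
  assumes "furstenberg_family \<A>" "disjoint_family_transitive \<A> Y N h"
  shows "disjoint_transitive Y N h"
  using assms
  unfolding furstenberg_family_def disjoint_family_transitive_def disjoint_transitive_def
  by (metis finite.emptyI)

theorem proposition3p8:
  fixes Z :: "'a topology" and \<A> :: "nat set set"
    and N :: nat and f :: "nat \<Rightarrow> 'a \<Rightarrow> 'a"
  assumes "Hausdorff_space Z"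
    and "no_isolated_points Z"
    and "furstenberg_family \<A>"
    and "N \<ge> 1"
    and "disjoint_family_transitive \<A> Z N f"
    and "\<exists>g. weakly_mixing_map Z g \<and>
           (\<forall>i\<in>{1..N}. \<forall>x\<in>topspace Z. g (f i x) = f i (g x))"
  shows "\<forall>r\<ge>1.
           disjoint_family_transitive \<A> (power_space r Z) N (\<lambda>i. power_map r (f i)) \<and>
           disjoint_weakly_mixing_of_order r Z N f"
proof (intro allI impI)
  fix r :: nat assume "r \<ge> 1"
  obtain g where wm: "weakly_mixing_map Z g"
    and comm: "\<And>i x. \<lbrakk>i \<in> {1..N}; x \<in> topspace Z\<rbrakk> \<Longrightarrow> g (f i x) = f i (g x)"
    using assms(6) by auto
  have cont: "\<And>i. i \<in> {1..N} \<Longrightarrow> continuous_map Z Z (f i)"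
    using assms(5) unfolding disjoint_family_transitive_def by blast
  have "disjoint_return_set N (\<lambda>i. power_map r (f i)) W \<in> \<A>"
    if W: "\<forall>j\<in>{0..N}. openin (power_space r Z) (W j) \<and> W j \<noteq> {}" for W
  proof -
    have "topspace (power_space r Z) \<noteq> {}"
      using W openin_subset[of "power_space r Z" "W 0"] by fastforce
    \<comment> \<open>Here \<open>r \<ge> 1\<close> matters: the zeroth power is a single point even
      when \<open>Z\<close> is empty.\<close>
    then have "topspace Z \<noteq> {}"
      using \<open>r \<ge> 1\<close> by (auto simp: power_space_def PiE_eq_empty_iff)
    then obtain V where "\<forall>j\<in>{0..N}. openin Z (V j) \<and> V j \<noteq> {}"
      "disjoint_return_set N f V \<subseteq> disjoint_return_set N (\<lambda>i. power_map r (f i)) W"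
      using disjoint_return_set_power_map[of Z g N f r W] wm comm cont W by blast
    then show ?thesis
      using assms(3,5) unfolding furstenberg_family_def disjoint_family_transitive_def by blast
  qed
  then have "disjoint_family_transitive \<A> (power_space r Z) N (\<lambda>i. power_map r (f i))"
    unfolding disjoint_family_transitive_def using continuous_map_power_map cont by blast
  then show "disjoint_family_transitive \<A> (power_space r Z) N (\<lambda>i. power_map r (f i)) \<and>
      disjoint_weakly_mixing_of_order r Z N f"
    using disjoint_family_transitive_imp_disjoint_transitive[OF assms(3)]
    unfolding disjoint_weakly_mixing_of_order_def by blast
qed

end
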